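(* Let $f(x)=\sum_{n\ge0}x^na_n$, $a_n\in\mathbb{O}$, be convergent in the octonionic unit ball $B_8(0,1)$. Then $f\in\mathcal{A}(B_8(0,1))$ if and only if $\sum_{n\ge0}\dfrac{|a_n|^2}{n+1}<\infty$.
   Context: $\mathbb{O}\cong\mathbb{R}^8$ denotes the (non-associative) octonions with norm $|x|=\sqrt{x\bar{x}}$; $B_8(0,1)=\{x\in\mathbb{O}:|x|<1\}$. $\mathbb{S}$ is the sphere of purely imaginary unit octonions and $\mathbb{C}_I=\mathbb{R}+\mathbb{R}I$ for $I\in\mathbb{S}$. A real differentiable $f:B_8(0,1)\to\mathbb{O}$ is slice monogenic if for every $I\in\mathbb{S}$ its restriction $f_I$ to $B_8(0,1)\cap\mathbb{C}_I$ satisfies $\frac12(\frac{\partial}{\partial u}+I\frac{\partial}{\partial v})f_I(u+Iv)=0$. The octonionic slice Bergman space $\mathcal{A}(B_8(0,1))$ is the set of slice monogenic $f$ on $B_8(0,1)$ such that $\int_{B_8(0,1)\cap\mathbb{C}_I}|f_I|^2\,d\tilde\sigma<\infty$ for some $I\in\mathbb{S}$ (equivalently for all $I$), where $d\tilde\sigma=du\,dv/{\rm area}(B_8(0,1)\cap\mathbb{C}_I)=du\,dv/\pi$. *)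

theory Defs
  imports "HOL-Analysis.Analysis"
begin

text \<open>
  The octonions are obtained from the complex numbers by applying the Cayley-Dickson doubling
  \<open>(a, b)(c, d) = (a c - d\<^sup>* b, d a + b c\<^sup>*)\<close>, \<open>(a, b)\<^sup>* = (a\<^sup>*, - b)\<close> twice. As they are iterated
  products, the real vector space structure, the Euclidean inner product and norm, and the topology
  of \<open>\<real>\<^sup>8\<close> are the ones of the product type.
\<close>

type_synonym quat = "complex \<times> complex"

type_synonym octonion = "quat \<times> quat"

definition qcnj :: "quat \<Rightarrow> quat"
  where "qcnj x = (cnj (fst x), - snd x)"

definition qmult :: "quat \<Rightarrow> quat \<Rightarrow> quat"
  where "qmult x y =
    (fst x * fst y - cnj (snd y) * snd x, snd y * fst x + snd x * cnj (fst y))"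

definition ocnj :: "octonion \<Rightarrow> octonion"
  where "ocnj x = (qcnj (fst x), - snd x)"

definition omult :: "octonion \<Rightarrow> octonion \<Rightarrow> octonion"  (infixl \<open>\<odot>\<close> 70)
  where "x \<odot> y =
    (qmult (fst x) (fst y) - qmult (qcnj (snd y)) (snd x),
     qmult (snd y) (fst x) + qmult (snd x) (qcnj (fst y)))"

definition oone :: octonion
  where "oone = ((1, 0), (0, 0))"

definition ore :: "octonion \<Rightarrow> real"
  where "ore x = Re (fst (fst x))"

text \<open>Powers need no bracketing convention, since the octonions are power-associative.\<close>

primrec opow :: "octonion \<Rightarrow> nat \<Rightarrow> octonion"
  where
    "opow x 0 = oone"
  | "opow x (Suc n) = x \<odot> opow x n"

lemmas octonion_defs = omult_def ocnj_def qmult_def qcnj_def oone_def ore_def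

lemma oone_mult [simp]: "oone \<odot> x = x" "x \<odot> oone = x"
  by (simp_all add: octonion_defs prod_eq_iff)

lemma ore_conv_ocnj: "ore x *\<^sub>R oone = (1/2) *\<^sub>R (x + ocnj x)"
  by (simp add: octonion_defs prod_eq_iff complex_eq_iff)

text \<open>The norm of the product type is the octonionic norm \<open>\<bar>x\<bar> = \<surd>(x x\<^sup>*)\<close>, and it is multiplicative.\<close>

lemma omult_ocnj: "x \<odot> ocnj x = (norm x)\<^sup>2 *\<^sub>R oone"
  by (simp add: octonion_defs prod_eq_iff complex_eq_iff norm_prod_def cmod_def power2_eq_square
      algebra_simps)

lemma norm_omult: "norm (x \<odot> y) = norm x * norm y"
proof -
  have "(norm (x \<odot> y))\<^sup>2 = (norm x * norm y)\<^sup>2"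
    by (simp add: octonion_defs norm_prod_def cmod_def power_mult_distrib)
       (simp add: power2_eq_square algebra_simps)
  then show ?thesis by simp
qed

lemma omult_left_alternative: "x \<odot> (x \<odot> y) = (x \<odot> x) \<odot> y"
  by (simp add: octonion_defs prod_eq_iff complex_eq_iff algebra_simps)

lemma omult_right_alternative: "(y \<odot> x) \<odot> x = y \<odot> (x \<odot> x)"
  by (simp add: octonion_defs prod_eq_iff complex_eq_iff algebra_simps)

definition imag_sphere :: "octonion set"
  where "imag_sphere = {I. ore I = 0 \<and> norm I = 1}"

text \<open>\<open>slice_pt I (u, v)\<close> is the point \<open>u + I v\<close> of the slice \<open>\<complex>\<^sub>I\<close>.\<close>

definition slice_pt :: "octonion \<Rightarrow> real \<times> real \<Rightarrow> octonion"
  where "slice_pt I p = fst p *\<^sub>R oone + snd p *\<^sub>R I"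

text \<open>
  Functions on the ball are represented by total functions; the notions below depend only on the
  values on the ball. The partial derivatives exist because \<open>f\<close> is real differentiable there.
\<close>

definition slice_monogenic :: "(octonion \<Rightarrow> octonion) \<Rightarrow> bool"
  where "slice_monogenic f \<longleftrightarrow>
    f differentiable_on ball 0 1 \<and>
    (\<forall>I\<in>imag_sphere. \<forall>u v. slice_pt I (u, v) \<in> ball 0 1 \<longrightarrow>
      (1/2) *\<^sub>R (vector_derivative (\<lambda>s. f (slice_pt I (s, v))) (at u)
        + I \<odot> vector_derivative (\<lambda>t. f (slice_pt I (u, t))) (at v)) = 0)"

text \<open>
  The normalised area measure \<open>du dv / area\<close> on the slice of the ball, in the coordinates
  \<open>(u, v)\<close>.
\<close>

definition slice_measure :: "octonion \<Rightarrow> (real \<times> real) measure"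
  where "slice_measure I = uniform_measure lborel {p. slice_pt I p \<in> ball 0 1}"

definition slice_bergman :: "(octonion \<Rightarrow> octonion) set"
  where "slice_bergman =
    {f. slice_monogenic f \<and>
        (\<exists>I\<in>imag_sphere.
          (\<integral>\<^sup>+ p. ennreal ((norm (f (slice_pt I p)))\<^sup>2) \<partial>slice_measure I) < \<infinity>)}"

end

theory Submission
  imports Defs
begin

text \<open>
  Fix an imaginary unit \<open>I\<close>. Left multiplication by elements of the slice \<open>\<complex>\<^sub>I\<close> makes the octonions a
  complex vector space: associativity could only fail in products \<open>(z w) y\<close> with \<open>z, w \<in> \<complex>\<^sub>I\<close>, and
  there left alternativity is enough (\<open>slice_elt_omult_omult\<close>). So on the slice, the power series
  is an ordinary power series with coefficients in a complex vector space, on which the unit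
  complex numbers act by isometries.

  Convergence in the ball makes \<open>\<Sum> n \<bar>a\<^sub>n\<bar> r\<^sup>n\<^sup>-\<^sup>1\<close> finite for \<open>r < 1\<close>. Hence the series may be differentiated
  term by term, as a function of eight real variables, and since every term satisfies the
  Cauchy-Riemann equation on each slice, so does the sum
  (\<open>octonion_power_series_slice_monogenic\<close>). What remains is the size of the integral, for which
  the identity
    \<open>\<integral> \<bar>f\<^sub>I\<bar>\<^sup>2 = \<Sum> \<bar>a\<^sub>n\<bar>\<^sup>2 / (n + 1)\<close>
  holds in \<open>[0, \<infinity>]\<close> (\<open>slice_integral_power_series\<close>). Its right-hand side is the same for every \<open>I\<close>,
  so that the choice of the slice does not matter.

  The identity is proved without polar coordinates. The normalised area of the disc is invariant
  under rotations, so the integral does not change if \<open>\<bar>f\<^sub>I\<bar>\<^sup>2\<close> is replaced by its mean over all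
  rotations. By Parseval on the circle (\<open>circle_parseval\<close>) this mean is \<open>\<Sum> \<bar>a\<^sub>n\<bar>\<^sup>2 \<bar>p\<bar>\<^sup>2\<^sup>n\<close> at the point \<open>p\<close>,
  and the moment of \<open>\<bar>p\<bar>\<^sup>2\<^sup>n\<close> is \<open>1 / (n + 1)\<close>, because \<open>\<bar>p\<bar>\<^sup>2\<close> is uniformly distributed on \<open>[0, 1]\<close>.
  All integrands being nonnegative, no integrability has to be known beforehand.
\<close>

section \<open>Octonion multiplication and slices\<close>

lemma bounded_bilinear_omult: "bounded_bilinear (\<odot>)"
proof
  show "\<exists>K. \<forall>x y. norm (x \<odot> y) \<le> norm x * norm y * K"
    by (rule exI[of _ 1]) (simp add: norm_omult)
qed (simp_all add: octonion_defs prod_eq_iff complex_eq_iff algebra_simps)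

interpretation omult: bounded_bilinear "(\<odot>)"
  by (rule bounded_bilinear_omult)

lemma norm_oone [simp]: "norm oone = 1"
  by (simp add: oone_def norm_prod_def)

lemma norm_opow: "norm (opow x n) = norm x ^ n"
  by (induction n) (simp_all add: norm_omult)

lemma imag_sphere_nonempty: "imag_sphere \<noteq> {}"
proof -
  have "((\<i>, 0), (0, 0)) \<in> imag_sphere"
    by (simp add: imag_sphere_def ore_def norm_prod_def)
  then show ?thesis by blast
qed

lemma imag_unit_square:
  assumes "I \<in> imag_sphere"
  shows "I \<odot> I = - oone"
proof -
  have "ocnj I = - I"
    using ore_conv_ocnj[of I] assms by (simp add: imag_sphere_def eq_neg_iff_add_eq_0 add.commute)
  then show ?thesis
    using omult_ocnj[of I] assms
    by (simp add: imag_sphere_def omult.minus_right minus_equation_iff)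
qed

lemma imag_unit_mult_twice:
  assumes "I \<in> imag_sphere"
  shows "I \<odot> (I \<odot> y) = - y"
  using assms by (simp add: omult_left_alternative imag_unit_square omult.minus_left)

text \<open>
  The point \<open>u + I v\<close> as a function of a complex number instead of a pair: in this form the
  parametrisation of the slice is a ring homomorphism.
\<close>

definition slice_elt :: "octonion \<Rightarrow> complex \<Rightarrow> octonion"
  where "slice_elt I z = slice_pt I (Re z, Im z)"

lemma slice_elt_1 [simp]: "slice_elt I 1 = oone"
  by (simp add: slice_elt_def slice_pt_def)

lemma slice_elt_ii [simp]: "slice_elt I \<i> = I"
  by (simp add: slice_elt_def slice_pt_def)

lemma slice_elt_0 [simp]: "slice_elt I 0 = 0"
  by (simp add: slice_elt_def slice_pt_def)

lemma slice_elt_add: "slice_elt I (z + w) = slice_elt I z + slice_elt I w"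
  by (simp add: slice_elt_def slice_pt_def algebra_simps)

lemma slice_elt_minus: "slice_elt I (- z) = - slice_elt I z"
  by (simp add: slice_elt_def slice_pt_def algebra_simps)

lemma slice_elt_omult: "slice_elt I z \<odot> y = Re z *\<^sub>R y + Im z *\<^sub>R (I \<odot> y)"
  by (simp add: slice_elt_def slice_pt_def omult.add_left omult.scaleR_left)

text \<open>
  The substitute for associativity: both factors are combinations of \<open>1\<close> and \<open>I\<close>, so only
  \<open>I (I y) = - y\<close> is needed.
\<close>

lemma slice_elt_omult_omult:
  assumes "I \<in> imag_sphere"
  shows "slice_elt I z \<odot> (slice_elt I w \<odot> y) = slice_elt I (z * w) \<odot> y"
  using assms
  by (simp add: slice_elt_omult omult.add_right omult.scaleR_right imag_unit_mult_twice algebra_simps)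

lemma slice_elt_mult:
  assumes "I \<in> imag_sphere"
  shows "slice_elt I z \<odot> slice_elt I w = slice_elt I (z * w)"
  using slice_elt_omult_omult[OF assms, of z w oone] by simp

lemma opow_slice_elt:
  assumes "I \<in> imag_sphere"
  shows "opow (slice_elt I z) n = slice_elt I (z ^ n)"
  by (induction n) (simp_all add: slice_elt_mult[OF assms])

text \<open>
  Polarisation of the multiplicativity of the norm.
\<close>

lemma inner_omult_left: "inner (x \<odot> a) (x \<odot> b) = (norm x)\<^sup>2 * inner a b"
proof -
  have "(norm (x \<odot> (a + b)))\<^sup>2 = (norm x)\<^sup>2 * (norm (a + b))\<^sup>2"
    "(norm (x \<odot> a))\<^sup>2 = (norm x)\<^sup>2 * (norm a)\<^sup>2"
    "(norm (x \<odot> b))\<^sup>2 = (norm x)\<^sup>2 * (norm b)\<^sup>2"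
    by (simp_all add: norm_omult power_mult_distrib)
  then show ?thesis
    by (simp only: power2_norm_eq_inner omult.add_right inner_add inner_commute[of b a]
        inner_commute[of "x \<odot> b" "x \<odot> a"] distrib_left)
qed

lemma inner_imag_unit_skew:
  assumes "I \<in> imag_sphere"
  shows "inner a (I \<odot> b) = - inner (I \<odot> a) b"
proof -
  have "inner (I \<odot> a) (I \<odot> (I \<odot> b)) = inner a (I \<odot> b)"
    using assms by (simp only: inner_omult_left) (simp add: imag_sphere_def)
  then show ?thesis
    by (simp add: imag_unit_mult_twice[OF assms])
qed

text \<open>
  Left multiplication by \<open>I\<close> is orthogonal with square \<open>- 1\<close>, hence skew-adjoint. Therefore the
  inner product of two multiples depends on \<open>z\<close> and \<open>w\<close> through \<open>z w\<^sup>*\<close> alone, as it does for a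
  Hermitian form.
\<close>

lemma inner_slice_elt_omult:
  assumes "I \<in> imag_sphere"
  shows "inner (slice_elt I z \<odot> a) (slice_elt I w \<odot> b)
    = Re (z * cnj w) * inner a b + Im (z * cnj w) * inner (I \<odot> a) b"
proof -
  have "inner (I \<odot> a) (I \<odot> b) = inner a b"
    using assms by (simp add: inner_omult_left imag_sphere_def)
  then show ?thesis
    by (simp add: slice_elt_omult inner_add inner_imag_unit_skew[OF assms, of a b] algebra_simps)
qed

lemma norm_slice_elt:
  assumes "I \<in> imag_sphere"
  shows "norm (slice_elt I z) = cmod z"
proof -
  have "inner I oone = 0"
    using assms by (simp add: imag_sphere_def ore_def oone_def inner_prod_def inner_complex_def)
  then have "(norm (slice_elt I z))\<^sup>2 = (cmod z)\<^sup>2"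
    using inner_slice_elt_omult[OF assms, of z oone z oone]
    by (simp add: dot_square_norm complex_mult_cnj cmod_power2)
  then show ?thesis by simp
qed

section \<open>Differentiation of octonionic power series\<close>

text \<open>
  The derivative of the power function at \<open>x\<close> in direction \<open>h\<close>, by the product rule. As \<open>h\<close> need not
  commute with \<open>x\<close>, there is no formula \<open>n x\<^sup>n\<^sup>-\<^sup>1 h\<close> in general; within a slice there is one.
\<close>

primrec opow_deriv :: "octonion \<Rightarrow> nat \<Rightarrow> octonion \<Rightarrow> octonion"
  where
    "opow_deriv x 0 h = 0"
  | "opow_deriv x (Suc n) h = h \<odot> opow x n + x \<odot> opow_deriv x n h"

lemma opow_has_derivative:
  "((\<lambda>x. opow x n) has_derivative opow_deriv x n) (at x within S)"
proof (induction n)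
  case (Suc n)
  from omult.FDERIV[OF has_derivative_ident Suc]
  show ?case
    by (simp add: add.commute fun_eq_iff)
qed (simp add: fun_eq_iff)

lemma norm_opow_deriv_le: "norm (opow_deriv x n h) \<le> real n * norm x ^ (n - 1) * norm h"
proof (induction n)
  case (Suc n)
  have "norm (opow_deriv x (Suc n) h) \<le> norm h * norm x ^ n + norm x * norm (opow_deriv x n h)"
    using norm_triangle_ineq[of "h \<odot> opow x n" "x \<odot> opow_deriv x n h"]
    by (simp add: norm_omult norm_opow)
  also have "\<dots> \<le> norm h * norm x ^ n + norm x * (real n * norm x ^ (n - 1) * norm h)"
    by (intro add_left_mono mult_left_mono Suc) auto
  also have "\<dots> = real (Suc n) * norm x ^ (Suc n - 1) * norm h"
    by (cases n) (simp_all add: algebra_simps)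
  finally show ?case .
qed simp

lemma opow_deriv_slice_elt:
  assumes "I \<in> imag_sphere"
  shows "opow_deriv (slice_elt I z) n (slice_elt I w) = slice_elt I (of_nat n * z ^ (n - 1) * w)"
proof (induction n)
  case (Suc n)
  have "opow_deriv (slice_elt I z) (Suc n) (slice_elt I w)
      = slice_elt I (w * z ^ n + z * (of_nat n * z ^ (n - 1) * w))"
    using Suc by (simp add: opow_slice_elt[OF assms] slice_elt_mult[OF assms] slice_elt_add)
  also have "w * z ^ n + z * (of_nat n * z ^ (n - 1) * w) = of_nat (Suc n) * z ^ (Suc n - 1) * w"
    by (cases n) (simp_all add: algebra_simps)
  finally show ?case .
qed simp

text \<open>
  Along the real axis the terms have norm \<open>\<bar>a\<^sub>n\<bar> s\<^sup>n\<close>; convergence bounds them for each \<open>s < 1\<close>, and a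
  geometric series in \<open>r / s\<close> dominates.
\<close>

lemma summable_norm_coeffs:
  assumes conv: "\<And>x. x \<in> ball 0 1 \<Longrightarrow> summable (\<lambda>n. opow x n \<odot> a n)" and r: "0 \<le> r" "r < 1"
  shows "summable (\<lambda>n. norm (a n) * r ^ n)"
proof -
  define s where "s = (r + 1) / 2"
  have s: "0 \<le> s" "r < s" "s < 1"
    using r by (auto simp: s_def)
  then have "summable (\<lambda>n. opow (s *\<^sub>R oone) n \<odot> a n)"
    by (intro conv) simp
  then have "Bseq (\<lambda>n. opow (s *\<^sub>R oone) n \<odot> a n)"
    using summable_LIMSEQ_zero convergentI convergent_imp_Bseq by blast
  then obtain M where "\<And>n. norm (opow (s *\<^sub>R oone) n \<odot> a n) \<le> M"
    using BseqE by blast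
  then have "\<And>n. norm (a n) * s ^ n \<le> M"
    using s by (simp add: norm_omult norm_opow mult.commute)
  then show ?thesis
    using Abel_lemma r s by blast
qed

lemma summable_deriv_coeffs:
  fixes c :: "nat \<Rightarrow> real"
  assumes conv: "\<And>r. 0 \<le> r \<Longrightarrow> r < 1 \<Longrightarrow> summable (\<lambda>n. c n * r ^ n)" and r: "0 \<le> r" "r < 1"
  shows "summable (\<lambda>n. real n * c n * r ^ (n - 1))"
proof -
  define s where "s = (r + 1) / 2"
  have s: "0 \<le> s" "r < s" "s < 1"
    using r by (auto simp: s_def)
  have "summable (\<lambda>n. diffs c n * r ^ n)"
  proof (rule termdiff_converges)
    show "norm r < s" using r s by simp
    show "summable (\<lambda>n. c n * x ^ n)" if "norm x < s" for x
      using powser_inside[OF conv[of s], of x] that s by simp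
  qed
  then show ?thesis
    by (subst summable_Suc_iff[symmetric]) (simp add: diffs_def)
qed

text \<open>
  On a ball of radius \<open>r < 1\<close> the derivatives of the terms are bounded by \<open>n \<bar>a\<^sub>n\<bar> r\<^sup>n\<^sup>-\<^sup>1 \<bar>h\<bar>\<close>, so the
  differentiated series converges uniformly there.
\<close>

lemma octonion_power_series_has_derivative:
  assumes conv: "\<And>x. x \<in> ball 0 1 \<Longrightarrow> (\<lambda>n. opow x n \<odot> a n) sums f x" and x: "x \<in> ball 0 1"
  shows "(f has_derivative (\<lambda>h. \<Sum>n. opow_deriv x n h \<odot> a n)) (at x)"
    and "summable (\<lambda>n. opow_deriv x n h \<odot> a n)"
proof -
  define r where "r = (norm x + 1) / 2"
  have r: "0 \<le> r" "norm x < r" "r < 1"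
    using x by (auto simp: r_def)
  define B where "B n = real n * norm (a n) * r ^ (n - 1)" for n
  have B: "summable B"
    unfolding B_def using r
    by (intro summable_deriv_coeffs summable_norm_coeffs) (auto intro!: sums_summable conv)
  have bound: "norm (opow_deriv y n h \<odot> a n) \<le> B n * norm h" if "y \<in> ball 0 r" for y n h
  proof -
    have "norm (opow_deriv y n h \<odot> a n) \<le> real n * norm y ^ (n - 1) * norm h * norm (a n)"
      unfolding norm_omult by (intro mult_right_mono norm_opow_deriv_le) simp
    also have "\<dots> \<le> real n * r ^ (n - 1) * norm h * norm (a n)"
      using that by (intro mult_right_mono mult_left_mono power_mono) auto
    finally show ?thesis by (simp add: B_def algebra_simps)
  qed
  have summ: "summable (\<lambda>n. norm (opow_deriv y n h \<odot> a n))" if "y \<in> ball 0 r" for y h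
    by (rule summable_comparison_test'[where N = 0, OF summable_mult2[OF B, of "norm h"]])
      (use bound[OF that] in simp)
  have tail: "norm ((\<Sum>i<n. opow_deriv y i h \<odot> a i) - (\<Sum>i. opow_deriv y i h \<odot> a i))
      \<le> (\<Sum>i. B (i + n)) * norm h" if "y \<in> ball 0 r" for y n h
  proof -
    note s = summ[OF that, of h]
    have "norm ((\<Sum>i<n. opow_deriv y i h \<odot> a i) - (\<Sum>i. opow_deriv y i h \<odot> a i))
        = norm (\<Sum>i. opow_deriv y (i + n) h \<odot> a (i + n))"
      using suminf_split_initial_segment[OF summable_norm_cancel[OF s], of n]
      by (simp add: norm_minus_commute)
    also have "\<dots> \<le> (\<Sum>i. norm (opow_deriv y (i + n) h \<odot> a (i + n)))"
      by (intro summable_norm summable_ignore_initial_segment[OF s])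
    also have "\<dots> \<le> (\<Sum>i. B (i + n) * norm h)"
      by (intro suminf_le bound that summable_mult2 summable_ignore_initial_segment[OF s]
          summable_ignore_initial_segment[OF B])
    also have "\<dots> = (\<Sum>i. B (i + n)) * norm h"
      by (intro suminf_mult2[symmetric] summable_ignore_initial_segment[OF B])
    finally show ?thesis .
  qed
  have "\<exists>g. \<forall>y\<in>ball 0 r. (\<lambda>n. opow y n \<odot> a n) sums g y \<and>
      (g has_derivative (\<lambda>h. \<Sum>n. opow_deriv y n h \<odot> a n)) (at y within ball 0 r)"
  proof (rule has_derivative_series)
    show "((\<lambda>x. opow x n \<odot> a n) has_derivative (\<lambda>h. opow_deriv y n h \<odot> a n)) (at y within ball 0 r)"
      for n y
      by (rule bounded_linear.has_derivative[OF omult.bounded_linear_left opow_has_derivative])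
    show "\<forall>\<^sub>F n in sequentially. \<forall>y\<in>ball 0 r. \<forall>h.
        norm ((\<Sum>i<n. opow_deriv y i h \<odot> a i) - (\<Sum>n. opow_deriv y n h \<odot> a n)) \<le> e * norm h"
      if "e > 0" for e
      using order_tendstoD(2)[OF suminf_exist_split2[OF B] that]
      by (eventually_elim, intro ballI allI)
        (rule order.trans[OF tail mult_right_mono], auto)
    show "x \<in> ball 0 r" "(\<lambda>n. opow x n \<odot> a n) sums f x"
      using r x conv by auto
  qed simp
  then obtain g where g: "\<And>y. y \<in> ball 0 r \<Longrightarrow> (\<lambda>n. opow y n \<odot> a n) sums g y"
    "\<And>y. y \<in> ball 0 r \<Longrightarrow>
      (g has_derivative (\<lambda>h. \<Sum>n. opow_deriv y n h \<odot> a n)) (at y within ball 0 r)"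
    by blast
  have xr: "x \<in> ball 0 r" using r by simp
  have "(g has_derivative (\<lambda>h. \<Sum>n. opow_deriv x n h \<odot> a n)) (at x)"
    using g(2)[OF xr] at_within_open[OF xr] by simp
  moreover have "g y = f y" if "y \<in> ball 0 r" for y
    using sums_unique2[OF g(1)[OF that] conv[of y]] that r by simp
  ultimately show "(f has_derivative (\<lambda>h. \<Sum>n. opow_deriv x n h \<odot> a n)) (at x)"
    using has_derivative_transform_within_open[of g _ x UNIV "ball 0 r" f] xr by simp
  show "summable (\<lambda>n. opow_deriv x n h \<odot> a n)"
    by (rule summable_norm_cancel[OF summ[OF xr]])
qed

text \<open>
  The directions \<open>1\<close> and \<open>I\<close> lie in the slice of the base point, where the \<open>n\<close>-th term has derivatives
  \<open>n z\<^sup>n\<^sup>-\<^sup>1 a\<^sub>n\<close> and \<open>(n z\<^sup>n\<^sup>-\<^sup>1 I) a\<^sub>n\<close>. Multiplying the latter by \<open>I\<close> gives the negative of the former.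
\<close>

lemma octonion_power_series_slice_monogenic:
  assumes conv: "\<And>x. x \<in> ball 0 1 \<Longrightarrow> (\<lambda>n. opow x n \<odot> a n) sums f x"
  shows "slice_monogenic f"
  unfolding slice_monogenic_def
proof (intro conjI ballI allI impI)
  show "f differentiable_on ball 0 1"
    unfolding differentiable_on_def differentiable_def
    using octonion_power_series_has_derivative(1)[OF conv] has_derivative_at_withinI by blast
next
  fix I u v
  assume I: "I \<in> imag_sphere" and uv: "slice_pt I (u, v) \<in> ball 0 1"
  define z where "z = Complex u v"
  have z: "slice_pt I (u, v) = slice_elt I z"
    by (simp add: z_def slice_elt_def)
  define D where "D = (\<lambda>h. \<Sum>n. opow_deriv (slice_elt I z) n h \<odot> a n)"
  have der: "(f has_derivative D) (at (slice_elt I z))"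
    using octonion_power_series_has_derivative(1)[OF conv uv] by (simp add: z D_def)
  interpret D: bounded_linear D
    using der by (rule has_derivative_bounded_linear)
  have "((\<lambda>s. slice_pt I (s, v)) has_derivative (\<lambda>h. h *\<^sub>R oone)) (at u)"
    unfolding slice_pt_def by (auto intro!: derivative_eq_intros)
  from has_derivative_compose[OF this, of f D]
  have "((\<lambda>s. f (slice_pt I (s, v))) has_vector_derivative D oone) (at u)"
    using der by (simp add: has_vector_derivative_def z D.scaleR)
  moreover have "((\<lambda>t. slice_pt I (u, t)) has_derivative (\<lambda>h. h *\<^sub>R I)) (at v)"
    unfolding slice_pt_def by (auto intro!: derivative_eq_intros)
  from has_derivative_compose[OF this, of f D]
  have "((\<lambda>t. f (slice_pt I (u, t))) has_vector_derivative D I) (at v)"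
    using der by (simp add: has_vector_derivative_def z D.scaleR)
  moreover have "D oone + I \<odot> D I = 0"
  proof -
    note s = octonion_power_series_has_derivative(2)[OF conv uv, unfolded z]
    have "I \<odot> D I = (\<Sum>n. I \<odot> (opow_deriv (slice_elt I z) n I \<odot> a n))"
      unfolding D_def by (rule bounded_linear.suminf[OF omult.bounded_linear_right s])
    also have "\<dots> = (\<Sum>n. - (opow_deriv (slice_elt I z) n oone \<odot> a n))"
    proof (rule suminf_cong)
      fix n
      have "I \<odot> (opow_deriv (slice_elt I z) n I \<odot> a n)
          = slice_elt I \<i> \<odot> (slice_elt I (of_nat n * z ^ (n - 1) * \<i>) \<odot> a n)"
        using opow_deriv_slice_elt[OF I, of z n \<i>] by simp
      also have "\<dots> = slice_elt I (- (of_nat n * z ^ (n - 1) * 1)) \<odot> a n"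
        by (subst slice_elt_omult_omult[OF I]) (simp add: algebra_simps)
      also have "\<dots> = - (opow_deriv (slice_elt I z) n (slice_elt I 1) \<odot> a n)"
        by (simp only: opow_deriv_slice_elt[OF I] slice_elt_minus omult.minus_left)
      finally show "I \<odot> (opow_deriv (slice_elt I z) n I \<odot> a n)
          = - (opow_deriv (slice_elt I z) n oone \<odot> a n)"
        by simp
    qed
    also have "\<dots> = - D oone"
      unfolding D_def by (rule suminf_minus[OF s])
    finally show ?thesis by simp
  qed
  ultimately show "(1/2) *\<^sub>R (vector_derivative (\<lambda>s. f (slice_pt I (s, v))) (at u)
      + I \<odot> vector_derivative (\<lambda>t. f (slice_pt I (u, t))) (at v)) = 0"
    by (simp add: vector_derivative_at)
qed

section \<open>Rotations of the plane and of the disc\<close>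

text \<open>
  On each horizontal line a shear is a translation.
\<close>

lemma nn_integral_lborel_shear_fst:
  fixes g :: "real \<times> real \<Rightarrow> ennreal"
  assumes [measurable]: "g \<in> borel_measurable borel"
  shows "(\<integral>\<^sup>+p. g (fst p + t * snd p, snd p) \<partial>lborel) = (\<integral>\<^sup>+p. g p \<partial>lborel)"
proof -
  have "(\<integral>\<^sup>+p. g (fst p + t * snd p, snd p) \<partial>(lborel \<Otimes>\<^sub>M lborel))
      = (\<integral>\<^sup>+y. \<integral>\<^sup>+x. g (t * y + 1 * x, y) \<partial>lborel \<partial>lborel)"
    by (subst lborel_pair.nn_integral_snd[symmetric]) (auto simp: borel_prod add.commute)
  also have "\<dots> = (\<integral>\<^sup>+y. \<integral>\<^sup>+x. g (x, y) \<partial>lborel \<partial>lborel)"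
  proof (rule nn_integral_cong)
    fix y
    show "(\<integral>\<^sup>+x. g (t * y + 1 * x, y) \<partial>lborel) = (\<integral>\<^sup>+x. g (x, y) \<partial>lborel)"
      using nn_integral_real_affine[of "\<lambda>x. g (x, y)" 1 "t * y"] by simp
  qed
  also have "\<dots> = (\<integral>\<^sup>+p. g p \<partial>(lborel \<Otimes>\<^sub>M lborel))"
    by (subst lborel_pair.nn_integral_snd) (simp_all add: lborel_prod measurable_lborel1)
  finally show ?thesis by (simp add: lborel_prod)
qed

lemma nn_integral_lborel_shear_snd:
  fixes g :: "real \<times> real \<Rightarrow> ennreal"
  assumes [measurable]: "g \<in> borel_measurable borel"
  shows "(\<integral>\<^sup>+p. g (fst p, snd p + t * fst p) \<partial>lborel) = (\<integral>\<^sup>+p. g p \<partial>lborel)"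
proof -
  have "(\<integral>\<^sup>+p. g (fst p, snd p + t * fst p) \<partial>(lborel \<Otimes>\<^sub>M lborel))
      = (\<integral>\<^sup>+x. \<integral>\<^sup>+y. g (x, t * x + 1 * y) \<partial>lborel \<partial>lborel)"
    by (subst lborel.nn_integral_fst[symmetric]) (auto simp: borel_prod add.commute)
  also have "\<dots> = (\<integral>\<^sup>+x. \<integral>\<^sup>+y. g (x, y) \<partial>lborel \<partial>lborel)"
  proof (rule nn_integral_cong)
    fix x
    show "(\<integral>\<^sup>+y. g (x, t * x + 1 * y) \<partial>lborel) = (\<integral>\<^sup>+y. g (x, y) \<partial>lborel)"
      using nn_integral_real_affine[of "\<lambda>y. g (x, y)" 1 "t * x"] by simp
  qed
  also have "\<dots> = (\<integral>\<^sup>+p. g p \<partial>(lborel \<Otimes>\<^sub>M lborel))"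
    by (subst lborel.nn_integral_fst) (simp_all add: lborel_prod measurable_lborel1)
  finally show ?thesis by (simp add: lborel_prod)
qed

definition rot :: "real \<Rightarrow> real \<times> real \<Rightarrow> real \<times> real"
  where "rot \<theta> p = (cos \<theta> * fst p - sin \<theta> * snd p, sin \<theta> * fst p + cos \<theta> * snd p)"

lemma continuous_on_rot [continuous_intros]:
  fixes S :: "'a::t2_space set"
  assumes "continuous_on S f" "continuous_on S g"
  shows "continuous_on S (\<lambda>x. rot (f x) (g x))"
  unfolding rot_def by (intro continuous_intros assms)

lemma measurable_rot [measurable]: "rot \<theta> \<in> borel_measurable borel"
  by (intro borel_measurable_continuous_onI continuous_intros)

lemma rot_rot: "rot \<theta> (rot \<phi> p) = rot (\<theta> + \<phi>) p"
  by (simp add: rot_def cos_add sin_add algebra_simps)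

lemma norm_rot [simp]: "norm (rot \<theta> p) = norm p"
proof -
  have "(cos \<theta> * fst p - sin \<theta> * snd p)\<^sup>2 + (sin \<theta> * fst p + cos \<theta> * snd p)\<^sup>2
      = ((sin \<theta>)\<^sup>2 + (cos \<theta>)\<^sup>2) * ((fst p)\<^sup>2 + (snd p)\<^sup>2)"
    by algebra
  then show ?thesis
    by (cases p) (simp add: rot_def norm_prod_def)
qed

text \<open>
  A rotation by an angle \<open>\<phi>\<close> with \<open>\<bar>\<phi>\<bar> < \<pi>\<close> is a product of three shears, with parameters
  \<open>- tan (\<phi> / 2)\<close>, \<open>sin \<phi>\<close>, \<open>- tan (\<phi> / 2)\<close>, and shears preserve area. The tangent is useless for the
  angles \<open>\<plusminus> \<pi>\<close>; composing two rotations by \<open>\<theta> / 2\<close> covers them too.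
\<close>

lemma nn_integral_lborel_rot:
  fixes g :: "real \<times> real \<Rightarrow> ennreal"
  assumes [measurable]: "g \<in> borel_measurable borel" and \<theta>: "\<bar>\<theta>\<bar> \<le> pi"
  shows "(\<integral>\<^sup>+p. g (rot \<theta> p) \<partial>lborel) = (\<integral>\<^sup>+p. g p \<partial>lborel)"
proof -
  have half: "(\<integral>\<^sup>+p. h (rot \<phi> p) \<partial>lborel) = (\<integral>\<^sup>+p. h p \<partial>lborel)"
    if [measurable]: "h \<in> borel_measurable borel" and \<phi>: "\<bar>\<phi>\<bar> < pi"
    for h :: "real \<times> real \<Rightarrow> ennreal" and \<phi>
  proof -
    define t where "t = - tan (\<phi> / 2)"
    have c: "cos (\<phi> / 2) > 0"
      using \<phi> by (intro cos_gt_zero_pi) auto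
    have s: "sin \<phi> = 2 * sin (\<phi> / 2) * cos (\<phi> / 2)"
      using sin_double[of "\<phi> / 2"] by simp
    have c2: "cos \<phi> = 1 - 2 * sin (\<phi> / 2) * sin (\<phi> / 2)"
      using cos_double_sin[of "\<phi> / 2"] by (simp add: power2_eq_square)
    have t1: "1 + t * sin \<phi> = cos \<phi>"
      unfolding t_def s c2 tan_def using c by (simp add: field_simps)
    have t2: "t + t * cos \<phi> = - sin \<phi>"
    proof -
      have "1 + cos \<phi> = 2 * cos (\<phi> / 2) * cos (\<phi> / 2)"
        using cos_double_cos[of "\<phi> / 2"] by (simp add: power2_eq_square)
      then have "t * (1 + cos \<phi>) = - sin \<phi>"
        unfolding t_def s tan_def using c by (simp add: field_simps)
      then show ?thesis by (simp add: algebra_simps)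
    qed
    define R where "R p = (fst p + t * snd p, snd p)" for p :: "real \<times> real"
    define U where "U p = (fst p, snd p + sin \<phi> * fst p)" for p :: "real \<times> real"
    have [measurable]: "R \<in> borel_measurable borel" "U \<in> borel_measurable borel"
      unfolding R_def U_def by (auto intro!: borel_measurable_continuous_onI continuous_intros)
    have eq: "rot \<phi> p = R (U (R p))" for p
    proof -
      have "fst p + t * snd p + t * (snd p + sin \<phi> * (fst p + t * snd p))
          = (1 + t * sin \<phi>) * fst p + (t + t * (1 + t * sin \<phi>)) * snd p"
        by (simp add: algebra_simps)
      moreover have "snd p + sin \<phi> * (fst p + t * snd p)
          = sin \<phi> * fst p + (1 + t * sin \<phi>) * snd p"
        by (simp add: algebra_simps)
      ultimately show ?thesis
        unfolding rot_def R_def U_def by (simp only: t1 t2 fst_conv snd_conv) simp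
    qed
    have shears: "(\<integral>\<^sup>+p. k (R p) \<partial>lborel) = (\<integral>\<^sup>+p. k p \<partial>lborel)"
        "(\<integral>\<^sup>+p. k (U p) \<partial>lborel) = (\<integral>\<^sup>+p. k p \<partial>lborel)"
      if "k \<in> borel_measurable borel" for k :: "real \<times> real \<Rightarrow> ennreal"
      unfolding R_def U_def
      by (rule nn_integral_lborel_shear_fst nn_integral_lborel_shear_snd, fact that)+
    have "(\<integral>\<^sup>+p. h (R (U (R p))) \<partial>lborel) = (\<integral>\<^sup>+p. h (R (U p)) \<partial>lborel)"
      by (rule shears(1)) measurable
    also have "\<dots> = (\<integral>\<^sup>+p. h (R p) \<partial>lborel)"
      by (rule shears(2)) measurable
    also have "\<dots> = (\<integral>\<^sup>+p. h p \<partial>lborel)"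
      by (rule shears(1)) measurable
    finally show ?thesis by (simp add: eq)
  qed
  have \<theta>2: "\<bar>\<theta> / 2\<bar> < pi" using \<theta> pi_gt_zero by linarith
  have "(\<integral>\<^sup>+p. g (rot \<theta> p) \<partial>lborel) = (\<integral>\<^sup>+p. g (rot (\<theta> / 2) (rot (\<theta> / 2) p)) \<partial>lborel)"
    by (simp add: rot_rot)
  also have "\<dots> = (\<integral>\<^sup>+p. g (rot (\<theta> / 2) p) \<partial>lborel)"
    by (rule half[OF _ \<theta>2]) measurable
  also have "\<dots> = (\<integral>\<^sup>+p. g p \<partial>lborel)"
    by (rule half[OF _ \<theta>2]) measurable
  finally show ?thesis .
qed

abbreviation unit_disc :: "(real \<times> real) set"
  where "unit_disc \<equiv> ball 0 1"

abbreviation disc_measure :: "(real \<times> real) measure"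
  where "disc_measure \<equiv> uniform_measure lborel unit_disc"

lemma emeasure_unit_disc: "emeasure lborel unit_disc = ennreal pi"
  by (simp add: emeasure_ball unit_ball_vol_2)

lemma emeasure_cdisc: "0 \<le> r \<Longrightarrow> emeasure lborel (cball (0::real \<times> real) r) = ennreal (pi * r\<^sup>2)"
  by (simp add: emeasure_cball unit_ball_vol_2 power2_eq_square)

lemma emeasure_disc_measure_UNIV: "emeasure disc_measure UNIV = 1"
  by (simp add: emeasure_uniform_measure emeasure_unit_disc ennreal_divide_self)

lemma nn_integral_disc_measure_rot:
  fixes g :: "real \<times> real \<Rightarrow> ennreal"
  assumes [measurable]: "g \<in> borel_measurable borel" and \<theta>: "\<bar>\<theta>\<bar> \<le> pi"
  shows "(\<integral>\<^sup>+p. g (rot \<theta> p) \<partial>disc_measure) = (\<integral>\<^sup>+p. g p \<partial>disc_measure)"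
proof -
  have [measurable]: "unit_disc \<in> sets borel"
    by simp
  have "indicator unit_disc p = (indicator unit_disc (rot \<theta> p) :: ennreal)" for p
    by (simp add: indicator_def)
  then have "(\<integral>\<^sup>+p. g (rot \<theta> p) * indicator unit_disc p \<partial>lborel)
      = (\<integral>\<^sup>+p. g (rot \<theta> p) * indicator unit_disc (rot \<theta> p) \<partial>lborel)"
    by simp
  also have "\<dots> = (\<integral>\<^sup>+p. g p * indicator unit_disc p \<partial>lborel)"
    by (rule nn_integral_lborel_rot[OF _ \<theta>]) measurable
  finally show ?thesis
    by (simp add: nn_integral_uniform_measure)
qed

text \<open>
  The disc of radius \<open>\<surd>x\<close> has normalised area \<open>x\<close>.
\<close>

lemma distr_norm_square_disc_measure:
  "distr disc_measure borel (\<lambda>p. (norm p)\<^sup>2) = uniform_measure lborel {0..1::real}"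
    (is "?M = ?N")
proof (rule measure_eqI_lessThan)
  have M: "emeasure ?M {x<..} = emeasure lborel (unit_disc \<inter> {p. x < (norm p)\<^sup>2}) / ennreal pi" for x
    by (subst emeasure_distr)
      (auto simp: emeasure_uniform_measure emeasure_unit_disc vimage_def Int_def 
        intro!: arg_cong2[where f = "(/)"] arg_cong2[where f = emeasure])
  have N: "emeasure ?N {x<..} = emeasure lborel ({0..1} \<inter> {x<..})" for x
    by (simp add: emeasure_uniform_measure divide_ennreal_def)
  show "emeasure ?M {x<..} < \<infinity>" for x
  proof -
    have "emeasure lborel (unit_disc \<inter> {p. x < (norm p)\<^sup>2}) \<le> emeasure lborel unit_disc"
      by (intro emeasure_mono) auto
    then have "emeasure lborel (unit_disc \<inter> {p. x < (norm p)\<^sup>2}) \<noteq> top"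
      by (rule neq_top_trans[rotated]) (simp add: emeasure_unit_disc)
    then show ?thesis
      unfolding M by (simp add: ennreal_divide_eq_top_iff less_top[symmetric])
  qed
  show "emeasure ?M {x<..} = emeasure ?N {x<..}" for x
  proof -
    consider "x < 0" | "0 \<le> x" "x < 1" | "1 \<le> x" by linarith
    then show ?thesis
    proof cases
      case 1
      then have "unit_disc \<inter> {p. x < (norm p)\<^sup>2} = unit_disc" "{0..1} \<inter> {x<..} = {0..1}"
        using less_le_trans[OF _ zero_le_power2] by auto
      then show ?thesis
        unfolding M N by (simp add: emeasure_unit_disc ennreal_divide_self)
    next
      case 2
      have "unit_disc \<inter> {p. x < (norm p)\<^sup>2} = unit_disc - cball 0 (sqrt x)"
      proof (rule set_eqI)
        fix p :: "real \<times> real"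
        show "p \<in> unit_disc \<inter> {p. x < (norm p)\<^sup>2} \<longleftrightarrow> p \<in> unit_disc - cball 0 (sqrt x)"
          using real_sqrt_less_iff[of x "(norm p)\<^sup>2"] by (simp add: not_le)
      qed
      moreover have "emeasure lborel (unit_disc - cball 0 (sqrt x)) = ennreal pi - ennreal (pi * x)"
      proof -
        have "sqrt x < 1"
          using 2 by simp
        then have "cball 0 (sqrt x) \<subseteq> unit_disc"
          using cball_subset_ball_iff[of 0 "sqrt x" 0 1] by simp
        then show ?thesis
          using 2 by (subst emeasure_Diff) (simp_all add: emeasure_unit_disc emeasure_cdisc)
      qed
      moreover have "(ennreal pi - ennreal (pi * x)) / ennreal pi = ennreal (1 - x)"
        using 2 by (subst ennreal_minus) (auto simp: divide_ennreal diff_divide_distrib)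
      moreover have "{0..1} \<inter> {x<..} = {x<..1}"
        using 2 by auto
      ultimately show ?thesis
        unfolding M N using 2 by (simp only: emeasure_lborel_Ioc less_imp_le)
    next
      case 3
      have "unit_disc \<inter> {p. x < (norm p)\<^sup>2} = {}"
      proof -
        have "\<not> x < (norm p)\<^sup>2" if "p \<in> unit_disc" for p
          using that 3 power_le_one[of "norm p" 2] by simp
        then show ?thesis by blast
      qed
      moreover have "{0..1} \<inter> {x<..} = {}" using 3 by auto
      ultimately show ?thesis
        unfolding M N by (simp only: emeasure_empty ennreal_zero_divide)
    qed
  qed
qed simp_all

lemma nn_integral_disc_measure_norm_power:
  "(\<integral>\<^sup>+p. ennreal ((norm p) ^ (2 * n)) \<partial>disc_measure) = ennreal (1 / (real n + 1))"
proof -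
  have "(\<integral>\<^sup>+p. ennreal ((norm p) ^ (2 * n)) \<partial>disc_measure)
      = (\<integral>\<^sup>+t. ennreal (t ^ n) \<partial>distr disc_measure borel (\<lambda>p. (norm p)\<^sup>2))"
    by (subst nn_integral_distr) (simp_all add: power_mult)
  also have "\<dots> = (\<integral>\<^sup>+t. ennreal (t ^ n) * indicator {0..1} t \<partial>lborel)"
    by (simp add: distr_norm_square_disc_measure nn_integral_uniform_measure divide_ennreal_def)
  also have "\<dots> = ennreal (1 ^ Suc n / real (Suc n) - 0 ^ Suc n / real (Suc n))"
  proof (rule nn_integral_FTC_Icc)
    show "((\<lambda>t. t ^ Suc n / real (Suc n)) has_real_derivative t ^ n) (at t)" for t
      using DERIV_cdivide[OF DERIV_pow[of "Suc n" t], of "real (Suc n)"] by simp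
  qed auto
  finally show ?thesis by (simp add: add.commute)
qed

section \<open>Parseval's identity on the circle\<close>

lemma has_integral_trig_circle:
  fixes k :: int
  assumes "k \<noteq> 0"
  shows "((\<lambda>\<theta>. cos (of_int k * \<theta>)) has_integral 0) {-pi..pi}"
    and "((\<lambda>\<theta>. sin (of_int k * \<theta>)) has_integral 0) {-pi..pi}"
proof -
  have "((\<lambda>\<theta>. cos (of_int k * \<theta>)) has_integral
      (sin (of_int k * pi) / of_int k - sin (of_int k * (- pi)) / of_int k)) {-pi..pi}"
    using assms by (intro fundamental_theorem_of_calculus)
      (auto simp: has_real_derivative_iff_has_vector_derivative[symmetric]
        intro!: derivative_eq_intros)
  then show "((\<lambda>\<theta>. cos (of_int k * \<theta>)) has_integral 0) {-pi..pi}"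
    using sin_npi_int[of k] by (simp add: mult.commute)
  have "((\<lambda>\<theta>. sin (of_int k * \<theta>)) has_integral
      (- cos (of_int k * pi) / of_int k - - cos (of_int k * (- pi)) / of_int k)) {-pi..pi}"
    using assms by (intro fundamental_theorem_of_calculus)
      (auto simp: has_real_derivative_iff_has_vector_derivative[symmetric]
        intro!: derivative_eq_intros)
  then show "((\<lambda>\<theta>. sin (of_int k * \<theta>)) has_integral 0) {-pi..pi}"
    by simp
qed

lemma circle_orthogonality:
  assumes I: "I \<in> imag_sphere"
  shows "((\<lambda>\<theta>. inner (slice_elt I (cis (real n * \<theta>)) \<odot> x) (slice_elt I (cis (real m * \<theta>)) \<odot> y))
    has_integral (if n = m then 2 * pi * inner x y else 0)) {-pi..pi}"
proof -
  define k where "k = int n - int m"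
  have eq: "inner (slice_elt I (cis (real n * \<theta>)) \<odot> x) (slice_elt I (cis (real m * \<theta>)) \<odot> y)
      = cos (of_int k * \<theta>) * inner x y + sin (of_int k * \<theta>) * inner (I \<odot> x) y" for \<theta>
  proof -
    have "cis (real n * \<theta>) * cnj (cis (real m * \<theta>)) = cis (of_int k * \<theta>)"
      by (simp add: cis_cnj cis_mult k_def algebra_simps)
    then show ?thesis
      by (simp add: inner_slice_elt_omult[OF I])
  qed
  show ?thesis
  proof (cases "n = m")
    case True
    then show ?thesis
      using has_integral_const_real[of "inner x y" "- pi" pi]
      unfolding eq by (simp add: k_def)
  next
    case False
    then have "k \<noteq> 0" by (simp add: k_def)
    from has_integral_add[OF has_integral_mult_left[OF has_integral_trig_circle(1)[OF this]]
        has_integral_mult_left[OF has_integral_trig_circle(2)[OF this]]]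
    show ?thesis using False by (simp add: eq)
  qed
qed

lemma circle_parseval_finite:
  assumes I: "I \<in> imag_sphere"
  shows "((\<lambda>\<theta>. (norm (\<Sum>n<N. slice_elt I (cis (real n * \<theta>)) \<odot> b n))\<^sup>2)
    has_integral (\<Sum>n<N. 2 * pi * (norm (b n))\<^sup>2)) {-pi..pi}"
proof -
  have "((\<lambda>\<theta>. \<Sum>n<N. \<Sum>m<N. inner (slice_elt I (cis (real m * \<theta>)) \<odot> b m)
        (slice_elt I (cis (real n * \<theta>)) \<odot> b n))
      has_integral (\<Sum>n<N. \<Sum>m<N. if m = n then 2 * pi * inner (b m) (b n) else 0)) {-pi..pi}"
    by (intro has_integral_sum circle_orthogonality[OF I]) auto
  then show ?thesis
    by (simp add: power2_norm_eq_inner inner_sum_left inner_sum_right sum.delta)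
qed

text \<open>
  The partial sums converge pointwise and are bounded by \<open>\<Sum> \<bar>b\<^sub>n\<bar>\<close>, so the finite identity passes to
  the limit.
\<close>

lemma circle_parseval:
  assumes I: "I \<in> imag_sphere" and b: "summable (\<lambda>n. norm (b n))"
  shows "(\<integral>\<^sup>+\<theta>. indicator {-pi..pi} \<theta> *
      ennreal ((norm (\<Sum>n. slice_elt I (cis (real n * \<theta>)) \<odot> b n))\<^sup>2) \<partial>lborel)
    = (\<Sum>n. ennreal (2 * pi * (norm (b n))\<^sup>2))"
proof -
  define S where "S N \<theta> = (\<Sum>n<N. slice_elt I (cis (real n * \<theta>)) \<odot> b n)" for N \<theta>
  define F where "F \<theta> = (\<Sum>n. slice_elt I (cis (real n * \<theta>)) \<odot> b n)" for \<theta>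
  have norm_term: "norm (slice_elt I (cis (real n * \<theta>)) \<odot> b n) = norm (b n)" for n \<theta>
    by (simp add: norm_omult norm_slice_elt[OF I])
  have int_S: "((\<lambda>\<theta>. (norm (S N \<theta>))\<^sup>2) has_integral (\<Sum>n<N. 2 * pi * (norm (b n))\<^sup>2)) {-pi..pi}" for N
    unfolding S_def by (rule circle_parseval_finite[OF I])
  have bound: "norm (S N \<theta>) \<le> (\<Sum>n. norm (b n))" for N \<theta>
    unfolding S_def
    using sum_le_suminf[OF b, of "{..<N}"]
    by (intro order.trans[OF norm_sum]) (simp add: norm_term)
  have lim: "(\<lambda>N. S N \<theta>) \<longlonglongrightarrow> F \<theta>" for \<theta>
    unfolding S_def F_def
    by (rule summable_LIMSEQ, rule summable_norm_cancel) (simp add: norm_term b)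
  have hyps: "(\<lambda>\<theta>. (norm (S N \<theta>))\<^sup>2) integrable_on {-pi..pi}"
    "(\<lambda>\<theta>::real. (\<Sum>n. norm (b n))\<^sup>2) integrable_on {-pi..pi}"
    "\<theta> \<in> {-pi..pi} \<Longrightarrow> norm ((norm (S N \<theta>))\<^sup>2) \<le> (\<Sum>n. norm (b n))\<^sup>2"
    "\<theta> \<in> {-pi..pi} \<Longrightarrow> (\<lambda>N. (norm (S N \<theta>))\<^sup>2) \<longlonglongrightarrow> (norm (F \<theta>))\<^sup>2" for N \<theta>
    using has_integral_integrable[OF int_S] integrable_const_ivl bound[of N \<theta>]
    by (auto intro!: power_mono tendsto_power tendsto_norm lim)
  note dom = dominated_convergence[OF hyps]
  have "(\<lambda>n. 2 * pi * (norm (b n))\<^sup>2) sums integral {-pi..pi} (\<lambda>\<theta>. (norm (F \<theta>))\<^sup>2)"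
    using dom(2) by (simp add: sums_def integral_unique[OF int_S])
  then have "(\<Sum>n. ennreal (2 * pi * (norm (b n))\<^sup>2))
      = ennreal (integral {-pi..pi} (\<lambda>\<theta>. (norm (F \<theta>))\<^sup>2))"
    by (intro suminf_ennreal_eq) auto
  moreover have "(\<integral>\<^sup>+\<theta>. indicator {-pi..pi} \<theta> * ennreal ((norm (F \<theta>))\<^sup>2) \<partial>lborel)
      = ennreal (integral {-pi..pi} (\<lambda>\<theta>. (norm (F \<theta>))\<^sup>2))"
    using nn_integral_has_integral_lebesgue[OF _ integrable_integral[OF dom(1)]]
    by (simp add: ennreal_mult' ennreal_indicator)
  ultimately show ?thesis
    by (simp add: F_def)
qed

section \<open>The Bergman norm of a power series\<close>

lemma cmod_Complex_fst_snd: "cmod (Complex (fst p) (snd p)) = norm p"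
  by (simp add: cmod_def norm_prod_def)

lemma norm_slice_pt:
  assumes "I \<in> imag_sphere"
  shows "norm (slice_pt I p) = norm p"
proof -
  have "slice_pt I p = slice_elt I (Complex (fst p) (snd p))"
    by (simp add: slice_elt_def)
  then show ?thesis
    by (simp add: norm_slice_elt[OF assms] cmod_Complex_fst_snd)
qed

text \<open>
  With \<open>z\<close> the complex coordinate of \<open>p\<close>, the rotated point has powers \<open>e\<^sup>i\<^sup>n\<^sup>\<theta> z\<^sup>n\<close>, so the Fourier
  coefficients are \<open>z\<^sup>n a\<^sub>n\<close>.
\<close>

lemma circle_mean_power_series:
  assumes conv: "\<And>x. x \<in> ball 0 1 \<Longrightarrow> (\<lambda>n. opow x n \<odot> a n) sums f x"
    and I: "I \<in> imag_sphere" and p: "p \<in> unit_disc"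
  shows "(\<integral>\<^sup>+\<theta>. indicator {-pi..pi} \<theta> * ennreal ((norm (f (slice_pt I (rot \<theta> p))))\<^sup>2) \<partial>lborel)
    = (\<Sum>n. ennreal (2 * pi * (norm (a n))\<^sup>2) * ennreal (norm p ^ (2 * n)))"
proof -
  define z where "z = Complex (fst p) (snd p)"
  have z: "slice_pt I (rot \<theta> p) = slice_elt I (cis \<theta> * z)" for \<theta>
    by (simp add: slice_elt_def rot_def z_def add.commute)
  have norm_z: "cmod z = norm p"
    by (simp add: z_def cmod_Complex_fst_snd)
  define b where "b n = slice_elt I (z ^ n) \<odot> a n" for n
  have norm_b: "norm (b n) = norm (a n) * norm p ^ n" for n
    by (simp add: b_def norm_omult norm_slice_elt[OF I] norm_power norm_z)
  have b: "summable (\<lambda>n. norm (b n))"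
    unfolding norm_b using p by (intro summable_norm_coeffs sums_summable[OF conv]) auto
  have "f (slice_pt I (rot \<theta> p)) = (\<Sum>n. slice_elt I (cis (real n * \<theta>)) \<odot> b n)" for \<theta>
  proof -
    have "slice_pt I (rot \<theta> p) \<in> ball 0 1"
      using p by (simp add: norm_slice_pt[OF I])
    from sums_unique[OF conv[OF this]] show ?thesis
      by (simp add: z b_def opow_slice_elt[OF I] slice_elt_omult_omult[OF I] power_mult_distrib
          Complex.DeMoivre)
  qed
  moreover have "ennreal (2 * pi * (norm (b n))\<^sup>2)
      = ennreal (2 * pi * (norm (a n))\<^sup>2) * ennreal (norm p ^ (2 * n))" for n
  proof -
    have "2 * pi * (norm (b n))\<^sup>2 = (2 * pi * (norm (a n))\<^sup>2) * norm p ^ (2 * n)"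
      by (simp add: norm_b power_mult_distrib power_even_eq)
    then show ?thesis by (metis ennreal_mult'' norm_ge_zero zero_le_power)
  qed
  ultimately show ?thesis
    using circle_parseval[OF I b] by simp
qed

lemma slice_measure_eq:
  assumes "I \<in> imag_sphere"
  shows "slice_measure I = disc_measure"
proof -
  have "{p. slice_pt I p \<in> ball 0 1} = unit_disc"
    by (auto simp: norm_slice_pt[OF assms])
  then show ?thesis by (simp add: slice_measure_def)
qed

lemma continuous_on_slice_pt: "continuous_on S (slice_pt I)"
  unfolding slice_pt_def by (intro continuous_intros)

text \<open>
  Both evaluations of \<open>\<integral>\<integral> g (rot \<theta> p) dp d\<theta>\<close>, where \<open>g\<close> is \<open>\<bar>f\<^sub>I\<bar>\<^sup>2\<close>: integrating over \<open>p\<close> first gives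
  \<open>2 \<pi> \<integral> g\<close> by rotation invariance, and integrating over \<open>\<theta>\<close> first gives the Parseval series.
\<close>

lemma slice_integral_power_series:
  assumes conv: "\<And>x. x \<in> ball 0 1 \<Longrightarrow> (\<lambda>n. opow x n \<odot> a n) sums f x"
    and I: "I \<in> imag_sphere"
  shows "(\<integral>\<^sup>+p. ennreal ((norm (f (slice_pt I p)))\<^sup>2) \<partial>slice_measure I)
    = (\<Sum>n. ennreal ((norm (a n))\<^sup>2 / (real n + 1)))"
proof -
  \<comment> \<open>Cut off outside the disc, where \<open>f\<close> is arbitrary and possibly not measurable.\<close>
  define g where "g p = ennreal (indicator unit_disc p *\<^sub>R (norm (f (slice_pt I p)))\<^sup>2)" for p
  have g_eq: "g p = ennreal ((norm (f (slice_pt I p)))\<^sup>2)" if "p \<in> unit_disc" for p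
    using that by (simp add: g_def)
  have "continuous_on (ball 0 1) f"
    using octonion_power_series_has_derivative(1)[OF conv]
    by (intro continuous_at_imp_continuous_on ballI has_derivative_continuous)
  then have "continuous_on unit_disc (\<lambda>p. (norm (f (slice_pt I p)))\<^sup>2)"
    by (intro continuous_intros continuous_on_compose2[OF _ continuous_on_slice_pt])
      (auto simp: norm_slice_pt[OF I])
  then have g [measurable]: "g \<in> borel_measurable borel"
    unfolding g_def
    by (intro measurable_compose[OF borel_measurable_continuous_on_indicator measurable_ennreal]) auto
  have rot_meas [measurable]: "(\<lambda>x. rot (fst x) (snd x)) \<in> borel_measurable borel"
    by (intro borel_measurable_continuous_onI continuous_intros)
  have AE: "AE p in disc_measure. p \<in> unit_disc"
    by (rule AE_uniform_measureI) auto
  interpret D: finite_measure disc_measure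
    by (rule finite_measureI) (simp add: emeasure_disc_measure_UNIV)
  interpret P: pair_sigma_finite lborel disc_measure ..
  have meas: "(\<lambda>x. indicator {-pi..pi} (fst x) * g (rot (fst x) (snd x)))
      \<in> borel_measurable (lborel \<Otimes>\<^sub>M disc_measure)"
  proof -
    have sets_eq: "sets (lborel \<Otimes>\<^sub>M disc_measure)
        = sets ((borel :: real measure) \<Otimes>\<^sub>M (borel :: (real \<times> real) measure))"
      by (intro sets_pair_measure_cong) auto
    moreover have "(\<lambda>x. indicator {-pi..pi} (fst x) * g (rot (fst x) (snd x))) \<in> borel_measurable borel"
      by (intro borel_measurable_times_ennreal measurable_compose[OF rot_meas g]
          measurable_compose[OF borel_measurable_continuous_onI[OF continuous_on_fst] borel_measurable_indicator])
        (auto intro: continuous_intros)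
    ultimately show ?thesis
      by (subst measurable_cong_sets[OF sets_eq refl]) (simp only: borel_prod)
  qed
  have "ennreal (2 * pi) * (\<integral>\<^sup>+p. g p \<partial>disc_measure)
      = (\<integral>\<^sup>+\<theta>. (\<integral>\<^sup>+p. g p \<partial>disc_measure) * indicator {-pi..pi} \<theta> \<partial>lborel)"
    by (subst nn_integral_cmult_indicator) (simp_all add: mult.commute)
  also have "\<dots> = (\<integral>\<^sup>+\<theta>. \<integral>\<^sup>+p. indicator {-pi..pi} \<theta> * g (rot \<theta> p) \<partial>disc_measure \<partial>lborel)"
  proof (rule nn_integral_cong)
    fix \<theta> :: real
    show "(\<integral>\<^sup>+p. g p \<partial>disc_measure) * indicator {-pi..pi} \<theta>
        = (\<integral>\<^sup>+p. indicator {-pi..pi} \<theta> * g (rot \<theta> p) \<partial>disc_measure)"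
      using nn_integral_disc_measure_rot[OF g, of \<theta>] by (auto simp: indicator_def)
  qed
  also have "\<dots> = (\<integral>\<^sup>+p. \<integral>\<^sup>+\<theta>. indicator {-pi..pi} \<theta> * g (rot \<theta> p) \<partial>lborel \<partial>disc_measure)"
    by (rule P.Fubini'[symmetric]) (use meas in \<open>simp only: case_prod_unfold\<close>)
  also have "\<dots> = (\<integral>\<^sup>+p. (\<Sum>n. ennreal (2 * pi * (norm (a n))\<^sup>2) * ennreal (norm p ^ (2 * n))) \<partial>disc_measure)"
  proof (rule nn_integral_cong_AE, use AE in eventually_elim)
    fix p :: "real \<times> real"
    assume p: "p \<in> unit_disc"
    then have "g (rot \<theta> p) = ennreal ((norm (f (slice_pt I (rot \<theta> p))))\<^sup>2)" for \<theta>
      by (intro g_eq) simp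
    then show "(\<integral>\<^sup>+\<theta>. indicator {-pi..pi} \<theta> * g (rot \<theta> p) \<partial>lborel)
        = (\<Sum>n. ennreal (2 * pi * (norm (a n))\<^sup>2) * ennreal (norm p ^ (2 * n)))"
      using circle_mean_power_series[OF conv I p] by simp
  qed
  also have "\<dots> = (\<Sum>n. ennreal (2 * pi * (norm (a n))\<^sup>2) * ennreal (1 / (real n + 1)))"
    by (subst nn_integral_suminf)
      (simp_all add: nn_integral_cmult nn_integral_disc_measure_norm_power)
  also have "\<dots> = (\<Sum>n. ennreal (2 * pi) * ennreal ((norm (a n))\<^sup>2 / (real n + 1)))"
    by (intro suminf_cong) (simp flip: ennreal_mult')
  also have "\<dots> = ennreal (2 * pi) * (\<Sum>n. ennreal ((norm (a n))\<^sup>2 / (real n + 1)))"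
    by (rule ennreal_suminf_cmult)
  finally have "(\<integral>\<^sup>+p. g p \<partial>disc_measure) = (\<Sum>n. ennreal ((norm (a n))\<^sup>2 / (real n + 1)))"
    by (subst (asm) ennreal_mult_cancel_left) auto
  moreover have "(\<integral>\<^sup>+p. g p \<partial>disc_measure)
      = (\<integral>\<^sup>+p. ennreal ((norm (f (slice_pt I p)))\<^sup>2) \<partial>disc_measure)"
    by (rule nn_integral_cong_AE, use AE in eventually_elim) (rule g_eq)
  ultimately show ?thesis
    by (simp add: slice_measure_eq[OF I])
qed

theorem proposition4p20:
  fixes f :: "octonion \<Rightarrow> octonion" and a :: "nat \<Rightarrow> octonion"
  assumes "\<And>x. x \<in> ball 0 1 \<Longrightarrow> (\<lambda>n. opow x n \<odot> a n) sums f x"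
  shows "f \<in> slice_bergman \<longleftrightarrow> summable (\<lambda>n. (norm (a n))\<^sup>2 / (real n + 1))"
proof -
  let ?c = "\<lambda>n. (norm (a n))\<^sup>2 / (real n + 1)"
  have "f \<in> slice_bergman \<longleftrightarrow> (\<Sum>n. ennreal (?c n)) < \<infinity>"
  proof -
    have "slice_monogenic f"
      using assms by (rule octonion_power_series_slice_monogenic)
    moreover have "(\<integral>\<^sup>+p. ennreal ((norm (f (slice_pt I p)))\<^sup>2) \<partial>slice_measure I)
        = (\<Sum>n. ennreal (?c n))" if "I \<in> imag_sphere" for I
      using assms that by (rule slice_integral_power_series)
    ultimately have "f \<in> slice_bergman \<longleftrightarrow> (\<exists>I\<in>imag_sphere. (\<Sum>n. ennreal (?c n)) < \<infinity>)"
      unfolding slice_bergman_def by (simp cong: bex_cong)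
    then show ?thesis
      using imag_sphere_nonempty by blast
  qed
  also have "\<dots> \<longleftrightarrow> summable ?c"
  proof
    assume "(\<Sum>n. ennreal (?c n)) < \<infinity>"
    then show "summable ?c"
      by (intro summable_suminf_not_top) auto
  next
    assume "summable ?c"
    then have "(\<Sum>n. ennreal (?c n)) = ennreal (\<Sum>n. ?c n)"
      by (intro suminf_ennreal2) auto
    then show "(\<Sum>n. ennreal (?c n)) < \<infinity>"
      by simp
  qed
  finally show ?thesis .
qed

end
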